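(* Let $\bar A'\in\{0,1\}^{n\times n}$, $\bar B'\in\{0,1\}^{n\times p}$, $\bar H\in\{0,1\}^{n\times n}$, and let $\bar E\in\{0,1\}^{r\times r}$ satisfy $\bar E_{i,i}=0$ for $i=1,\dots,r$. Let $(\bar A,\bar B)$ be the structural system composed of $r$ similar components parametrized by $(\bar A',\bar B',\bar H,\bar E)$, i.e. $\bar A=(I_r\otimes \bar A')\lor(\bar E\otimes\bar H)$ and $\bar B=I_r\otimes \bar B'$. Suppose that $(\bar A',\bar B')$ is not structurally controllable and that the system bipartite graph $\mathcal B(\bar A',\bar B')$ has a matching without right-unmatched vertices. Then $(\bar A,\bar B)$ is structurally controllable if and only if $(\bar A'\lor\bar H,\bar B')$ is structurally controllable and the condensed graph $\mathcal D^*(\bar A)$ has no sources.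
   Context: Here $\otimes$ is the Kronecker product and $\lor$ the entrywise logical OR of binary matrices. Structural controllability: for binary matrices $\bar M\in\{0,1\}^{n\times n}$ and $\bar N\in\{0,1\}^{n\times p}$, the pair $(\bar M,\bar N)$ is structurally controllable if there is a controllable pair of real matrices $(M,N)$ (for $\dot x=Mx+Nu$) with the same sparsity pattern, i.e. $M_{i,j}=0$ iff $\bar M_{i,j}=0$ and $N_{i,k}=0$ iff $\bar N_{i,k}=0$. System bipartite graph: with state vertices $\mathcal X=\{x_1,\dots,x_n\}$ and input vertices $\mathcal U=\{u_1,\dots,u_p\}$, $\mathcal B(\bar M,\bar N)$ is the bipartite graph with left vertex set $\mathcal U\cup\mathcal X$, right vertex set $\mathcal X$ (a separate copy), an edge from left $x_i$ to right $x_j$ iff $\bar M_{j,i}=1$, and an edge from left $u_j$ to right $x_i$ iff $\bar N_{i,j}=1$. A matching is a set of edges no two of which share a vertex; a right vertex is right-unmatched with respect to a matching if it belongs to none of its edges. Condensed graph: $\mathcal D^*(\bar A)$ is the digraph with vertices $a_1,\dots,a_r$ (one per subsystem) and an edge $(a_i,a_j)$ from $a_i$ to $a_j$ whenever there is a nonzero connection matrix from subsystem $i$ to subsystem $j$; for a system composed of similar components parametrized by $(\bar A',\bar B',\bar H,\bar E)$ it is the digraph $\mathcal D(\bar E)$, having an edge $(a_i,a_j)$ iff $\bar E_{j,i}=1$. A source is a vertex at which no directed edge ends. *)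

theory Defs
  imports "HOL-Analysis.Analysis" "HOL-Library.Z2"
begin

text \<open>
  Binary matrices have entries in \<open>bit\<close>, which is used here only for its two elements
  \<open>0\<close> and \<open>1\<close>, its multiplication and its bitwise \<open>or\<close>; its addition (modulo 2) plays no role.
\<close>

definition matrix_or :: "bit ^ 'm ^ 'n \<Rightarrow> bit ^ 'm ^ 'n \<Rightarrow> bit ^ 'm ^ 'n" (infixl "\<or>\<^sub>m" 65)
  where "A \<or>\<^sub>m B = (\<chi> i j. or (A $ i $ j) (B $ i $ j))"

text \<open>
  Rows and columns of a Kronecker product are indexed by pairs, the first component being
  the block and the second one the position inside the block.
\<close>

definition kronecker ::
  "'a::times ^ 'm ^ 'k \<Rightarrow> 'a ^ 'p ^ 'n \<Rightarrow> 'a ^ ('m \<times> 'p) ^ ('k \<times> 'n)" (infixl "\<otimes>\<^sub>m" 70)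
  where "A \<otimes>\<^sub>m B = (\<chi> a b. A $ fst a $ fst b * B $ snd a $ snd b)"

text \<open>
  Controllability of \<open>x' = M x + N u\<close>: every state can be steered to every other state
  in finite time. The inputs are continuous functions of time.
\<close>

definition controllable :: "real ^ 'n ^ 'n \<Rightarrow> real ^ 'p ^ 'n \<Rightarrow> bool"
  where "controllable M N \<longleftrightarrow>
    (\<forall>x\<^sub>0 x\<^sub>1. \<exists>T>0. \<exists>(u :: real \<Rightarrow> real ^ 'p) (x :: real \<Rightarrow> real ^ 'n).
       continuous_on {0..T} u \<and> x 0 = x\<^sub>0 \<and> x T = x\<^sub>1 \<and>
       (\<forall>t\<in>{0..T}. (x has_vector_derivative M *v x t + N *v u t) (at t within {0..T})))"

definition same_sparsity :: "real ^ 'm ^ 'n \<Rightarrow> bit ^ 'm ^ 'n \<Rightarrow> bool"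
  where "same_sparsity M S \<longleftrightarrow> (\<forall>i j. M $ i $ j = 0 \<longleftrightarrow> S $ i $ j = 0)"

definition structurally_controllable :: "bit ^ 'n ^ 'n \<Rightarrow> bit ^ 'p ^ 'n \<Rightarrow> bool"
  where "structurally_controllable S R \<longleftrightarrow>
    (\<exists>M N. same_sparsity M S \<and> same_sparsity N R \<and> controllable M N)"

text \<open>
  An edge of the system bipartite graph is a pair of a left and a right vertex; the left
  vertices are the inputs (\<open>Inl\<close>) and the states (\<open>Inr\<close>), the right vertices a copy of the states.
\<close>

definition system_bipartite_edges :: "bit ^ 'n ^ 'n \<Rightarrow> bit ^ 'p ^ 'n \<Rightarrow> (('p + 'n) \<times> 'n) set"
  where "system_bipartite_edges S R =
    {(Inr i, j) |i j. S $ j $ i = 1} \<union> {(Inl j, i) |j i. R $ i $ j = 1}"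

definition bipartite_matching :: "('l \<times> 'r) set \<Rightarrow> ('l \<times> 'r) set \<Rightarrow> bool"
  where "bipartite_matching G F \<longleftrightarrow>
    F \<subseteq> G \<and> (\<forall>e\<in>F. \<forall>f\<in>F. e \<noteq> f \<longrightarrow> fst e \<noteq> fst f \<and> snd e \<noteq> snd f)"

definition right_unmatched :: "('l \<times> 'r) set \<Rightarrow> 'r \<Rightarrow> bool"
  where "right_unmatched F v \<longleftrightarrow> (\<forall>e\<in>F. snd e \<noteq> v)"

text \<open>
  The condensed graph of a system of similar components, as an edge relation on the
  subsystem indices. It depends on the connection pattern \<open>E\<close> only.
\<close>

definition condensed_graph :: "bit ^ 'r ^ 'r \<Rightarrow> 'r rel"
  where "condensed_graph E = {(i, j). E $ j $ i = 1}"

definition is_source :: "'r rel \<Rightarrow> 'r \<Rightarrow> bool"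
  where "is_source D v \<longleftrightarrow> (\<forall>u. (u, v) \<notin> D)"

definition composed_dynamics ::
  "bit ^ 'n ^ 'n \<Rightarrow> bit ^ 'n ^ 'n \<Rightarrow> bit ^ 'r ^ 'r \<Rightarrow> bit ^ ('r \<times> 'n) ^ ('r \<times> 'n)"
  where "composed_dynamics A' H E = (mat 1 \<otimes>\<^sub>m A') \<or>\<^sub>m (E \<otimes>\<^sub>m H)"

definition composed_input :: "bit ^ 'p ^ 'n \<Rightarrow> bit ^ ('r::finite \<times> 'p) ^ ('r \<times> 'n)"
  where "composed_input B' = mat 1 \<otimes>\<^sub>m B'"

end

theory Submission
  imports Defs
begin

text \<open>
  Everything reduces to Lin's graph criterion. A pair of patterns whose system bipartite graph has
  a matching without right-unmatched vertices is structurally controllable iff every state can be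
  reached from an input along edges of the pattern. A matching of the isolated component is one of
  \<open>(A' \<or>\<^sub>m H, B')\<close>, and its copies in all blocks form one of the composed system, so the criterion
  applies to all three systems and the theorem becomes a statement on reachability. Forgetting the
  subsystem index turns a path of the composed system into one of \<open>(A' \<or>\<^sub>m H, B')\<close>. A path that
  ends in a source subsystem never left it, so it is a path of the isolated component; but some
  state of the isolated component cannot be reached, as that component is not structurally
  controllable. Conversely, a path of \<open>(A' \<or>\<^sub>m H, B')\<close> lifts backwards from any subsystem: an edge
  of \<open>A'\<close> stays in the block, and an edge of \<open>H\<close> comes from a predecessor in the condensed
  graph, which exists because there are no sources.
  
  Unreachable states evolve autonomously, so they stay at \<open>0\<close> when started there: this is the
  necessity of reachability (\<open>structurally_controllable_imp_input_reachable\<close>).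
  
  Sufficiency (\<open>reachable_matched_imp_structurally_controllable\<close>) is proved by adding the states one
  at a time, without decomposing the graph into cacti. If \<open>X\<close> is reachable and matched, then some
  \<open>m \<in> X\<close> can be removed such that \<open>X - {m}\<close> is still reachable and all of \<open>X\<close> is still matched
  by inputs and states of \<open>X - {m}\<close> (\<open>exists_removable_state\<close>). Let \<open>(M, N)\<close> be controllable on
  \<open>X - {m}\<close>, and add to it \<open>e\<close> times the 0-1 matrices of this matching. For small \<open>e\<close> the new pair
  is still controllable on \<open>X - {m}\<close>, and, unless \<open>- e\<close> is one of finitely many eigenvalues, the
  rows of \<open>[M N]\<close> in \<open>X\<close> are independent. A covector \<open>v\<close> on \<open>X\<close> that annihilates every \<open>M ^ k N\<close> is mapped by
  \<open>M\<close> to one on \<open>X - {m}\<close>, as no edge leaves \<open>m\<close>; hence \<open>v M = 0\<close> and \<open>v N = 0\<close>, and \<open>v = 0\<close> by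
  independence (\<open>kalman_on_add_state\<close>). Controllability being an open condition, the pattern edges
  that are still missing can finally be given small weights.
  
  Kalman's rank condition is turned into controllability by polynomial inputs. For a relation
  \<open>M ^ K = (\<Sum>k<K. c k M ^ k)\<close> put \<open>x = (\<Sum>k<K. M ^ k N \<phi> k)\<close>. Choosing \<open>\<phi> (K - 1)\<close> freely and
  \<open>\<phi> (k - 1) = (\<phi> k)' - c k \<phi> (K - 1)\<close> makes \<open>x\<close> a trajectory with input
  \<open>(\<phi> 0)' - c 0 \<phi> (K - 1)\<close>, and Hermite interpolation prescribes all \<open>\<phi> k\<close> at both end points
  (\<open>kalman_imp_controllable\<close>).
\<close>

section \<open>From Kalman's rank condition to controllability\<close>

text \<open>
  Kalman's rank condition in dual form, for covectors supported on \<open>X\<close>. The matrices keep their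
  full index type, so that growing \<open>X\<close> by one state does not change the type of the system.
\<close>

definition kalman_on :: "'n set \<Rightarrow> real ^ 'n ^ 'n \<Rightarrow> real ^ 'p ^ 'n \<Rightarrow> bool"
  where "kalman_on X M N \<longleftrightarrow>
    (\<forall>v. (\<forall>i. i \<notin> X \<longrightarrow> v $ i = 0) \<longrightarrow> (\<forall>k. ((\<lambda>w. w v* M) ^^ k) v v* N = 0) \<longrightarrow> v = 0)"

lemma sequence_eventually_in_span_of_predecessors:
  fixes P :: "nat \<Rightarrow> 'a :: euclidean_space"
  shows "\<exists>K. P K \<in> span (P ` {..<K})"
proof (rule ccontr)
  assume "\<not> ?thesis"
  then have new: "P k \<notin> span (P ` {..<k})" for k
    by blast
  have "independent (P ` {..<k}) \<and> card (P ` {..<k}) = k" for k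
  proof (induction k)
    case (Suc k)
    then show ?case
      using new[of k] span_base[of "P k" "P ` {..<k}"]
      by (auto simp: lessThan_Suc independent_insert)
  qed (simp add: independent_empty)
  then have "Suc DIM('a) \<le> DIM('a)"
    by (metis independent_bound)
  then show False
    by simp
qed

lemma span_image_lessThanD:
  fixes P :: "nat \<Rightarrow> 'a :: real_vector"
  assumes "x \<in> span (P ` {..<K})"
  shows "\<exists>c. x = (\<Sum>k<K. c k *\<^sub>R P k)"
  using assms
proof (induction K arbitrary: x)
  case (Suc K)
  then obtain a where "x - a *\<^sub>R P K \<in> span (P ` {..<K})"
    by (auto simp: lessThan_Suc span_insert)
  then obtain c where "x - a *\<^sub>R P K = (\<Sum>k<K. c k *\<^sub>R P k)"
    using Suc.IH by blast
  then have "x = (\<Sum>k<Suc K. (c(K := a)) k *\<^sub>R P k)"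
    by (simp add: algebra_simps)
  then show ?case
    by blast
qed auto

text \<open>
  The role of the Cayley-Hamilton theorem is played by any such relation, so \<open>K\<close> may be arbitrary:
  the matrices form a space of finite dimension, hence some power of \<open>M\<close> depends on the lower ones.
\<close>

lemma exists_annihilating_power_relation:
  fixes M :: "real ^ 'n ^ 'n"
  shows "\<exists>K c. \<forall>x. (((*v) M) ^^ K) x = (\<Sum>k<K. c k *\<^sub>R (((*v) M) ^^ k) x)"
proof -
  define P where "P k = (((**) M) ^^ k) (mat 1)" for k
  have P: "P k *v x = (((*v) M) ^^ k) x" for k x
    by (induction k) (simp_all add: P_def flip: matrix_vector_mul_assoc)
  obtain K where "P K \<in> span (P ` {..<K})"
    using sequence_eventually_in_span_of_predecessors by blast
  then obtain c where c: "P K = (\<Sum>k<K. c k *\<^sub>R P k)"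
    using span_image_lessThanD by blast
  have "(\<Sum>k<L. c k *\<^sub>R P k) *v x = (\<Sum>k<L. c k *\<^sub>R (P k *v x))" for L x
    by (induction L) (simp_all add: matrix_vector_mult_add_rdistrib scaleR_matrix_vector_assoc)
  then have "P K *v x = (\<Sum>k<K. c k *\<^sub>R (P k *v x))" for x
    by (simp only: c)
  then show ?thesis
    unfolding P by blast
qed

lemma inner_vector_matrix_power:
  fixes v y :: "real ^ 'n" and M :: "real ^ 'n ^ 'n"
  shows "((\<lambda>w. w v* M) ^^ k) v \<bullet> y = v \<bullet> (((*v) M) ^^ k) y"
proof (induction k arbitrary: v)
  case (Suc k)
  have "((\<lambda>w. w v* M) ^^ Suc k) v = ((\<lambda>w. w v* M) ^^ k) (v v* M)"
    by (simp only: funpow_Suc_right o_apply)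
  then show ?case
    by (simp add: Suc dot_lmul_matrix)
qed simp

text \<open>
  If the subspace of these sums were proper, it would have a nonzero normal vector. The power
  relation carries orthogonality to \<open>M ^ k N\<close> from \<open>k < K\<close> to all \<open>k\<close>, which contradicts the dual
  condition.
\<close>

lemma kalman_imp_state_decomposition:
  fixes M :: "real ^ 'n ^ 'n" and N :: "real ^ 'p ^ 'n"
  assumes kal: "kalman_on UNIV M N"
    and rel: "\<And>x. (((*v) M) ^^ K) x = (\<Sum>k<K. c k *\<^sub>R (((*v) M) ^^ k) x)"
  shows "\<exists>a. x = (\<Sum>k<K. \<Sum>j\<in>UNIV. a j k *\<^sub>R (((*v) M) ^^ k) (column j N))"
proof -
  define b where "b j k = (((*v) M) ^^ k) (column j N)" for j k
  have lin: "linear ((((*v) M)) ^^ k)" for k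
  proof (induction k)
    case (Suc k)
    then show ?case
      using linear_compose[OF Suc matrix_vector_mul_linear[of M]] by (simp only: funpow.simps)
  qed (simp add: linear_iff)
  let ?W = "{x. \<exists>a. x = (\<Sum>k<K. \<Sum>j\<in>UNIV. a j k *\<^sub>R b j k)}"
  have sub: "subspace ?W"
  proof (rule subspaceI)
    show "0 \<in> ?W"
      by (intro CollectI exI[of _ "\<lambda>_ _. 0"]) simp
    show "x + y \<in> ?W" if xy: "x \<in> ?W" "y \<in> ?W" for x y
    proof -
      from xy obtain a a' where "x = (\<Sum>k<K. \<Sum>j\<in>UNIV. a j k *\<^sub>R b j k)"
        "y = (\<Sum>k<K. \<Sum>j\<in>UNIV. a' j k *\<^sub>R b j k)"
        by blast
      then have "x + y = (\<Sum>k<K. \<Sum>j\<in>UNIV. (a j k + a' j k) *\<^sub>R b j k)"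
        by (simp add: sum.distrib scaleR_left_distrib)
      then show ?thesis
        by (intro CollectI exI[of _ "\<lambda>j k. a j k + a' j k"])
    qed
    show "r *\<^sub>R x \<in> ?W" if x: "x \<in> ?W" for r x
    proof -
      from x obtain a where "x = (\<Sum>k<K. \<Sum>j\<in>UNIV. a j k *\<^sub>R b j k)"
        by blast
      then have "r *\<^sub>R x = (\<Sum>k<K. \<Sum>j\<in>UNIV. (r * a j k) *\<^sub>R b j k)"
        by (simp add: scaleR_sum_right)
      then show ?thesis
        by (intro CollectI exI[of _ "\<lambda>j k. r * a j k"])
    qed
  qed
  have base: "b j k \<in> ?W" if "k < K" for j k
  proof -
    have "b j k = (\<Sum>k'<K. \<Sum>j'\<in>UNIV. (if k' = k \<and> j' = j then 1 else 0) *\<^sub>R b j' k')"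
    proof -
      have ite: "(if P then 1 else 0) *\<^sub>R y = (if P then y else 0)" for P and y :: "real ^ 'n"
        by simp
      have "(\<Sum>k'<K. \<Sum>j'\<in>UNIV. (if k' = k \<and> j' = j then 1 else 0) *\<^sub>R b j' k')
          = (\<Sum>k'<K. if k' = k then b j k else 0)"
      proof (intro sum.cong refl)
        fix k'
        show "(\<Sum>j'\<in>UNIV. (if k' = k \<and> j' = j then 1 else 0) *\<^sub>R b j' k') = (if k' = k then b j k else 0)"
          by (cases "k' = k") (simp_all add: ite)
      qed
      also have "\<dots> = b j k"
        using that by simp
      finally show ?thesis ..
    qed
    then show ?thesis
      by (intro CollectI exI[of _ "\<lambda>j' k'. if k' = k \<and> j' = j then 1 else 0"])
  qed
  have "span ?W = UNIV"
  proof (rule ccontr)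
    assume "span ?W \<noteq> UNIV"
    then obtain v where v: "v \<noteq> 0" "\<And>x. x \<in> span ?W \<Longrightarrow> v \<bullet> x = 0"
      using span_not_UNIV_orthogonal[of ?W] by blast
    have vb: "v \<bullet> b j k = 0" for j k
    proof (induction k rule: less_induct)
      case (less k)
      show ?case
      proof (cases "k < K")
        case True
        then show ?thesis
          by (intro v(2) span_base base)
      next
        case False
        then obtain l where k: "k = l + K"
          by (metis le_add_diff_inverse2 not_less)
        have "b j k = (((*v) M) ^^ l) ((((*v) M) ^^ K) (column j N))"
          by (simp add: b_def k funpow_add)
        also have "\<dots> = (\<Sum>i<K. c i *\<^sub>R b j (l + i))"
          by (simp add: rel linear_sum[OF lin] linear_cmul[OF lin] b_def funpow_add)
        finally show ?thesis
          using less k by (simp add: inner_sum_right)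
      qed
    qed
    have "((\<lambda>w. w v* M) ^^ k) v v* N = 0" for k
    proof (rule vec_eq_iff[THEN iffD2], rule allI)
      fix j
      have "(((\<lambda>w. w v* M) ^^ k) v v* N) $ j = ((\<lambda>w. w v* M) ^^ k) v \<bullet> column j N"
        by (simp add: vector_matrix_mult_def inner_vec_def column_def mult.commute)
      also have "\<dots> = 0"
        using vb by (simp add: inner_vector_matrix_power b_def)
      finally show "(((\<lambda>w. w v* M) ^^ k) v v* N) $ j = 0 $ j"
        by simp
    qed
    then show False
      using kal v(1) unfolding kalman_on_def by (metis UNIV_I)
  qed
  then have "?W = UNIV"
    by (simp only: span_eq_iff[THEN iffD2, OF sub])
  then have "x \<in> ?W"
    by (simp only: UNIV_I)
  then show ?thesis
    unfolding b_def by (simp only: mem_Collect_eq)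
qed

text \<open>
  The coordinates of the trajectory along \<open>M ^ k N\<close>, counted downwards from \<open>k = K - 1\<close>: all are
  determined by the top coordinate \<open>q\<close>, and the last member of the chain is the input.
\<close>

primrec feedback_chain :: "(nat \<Rightarrow> real) \<Rightarrow> real poly \<Rightarrow> nat \<Rightarrow> real poly"
  where "feedback_chain c q 0 = q"
  | "feedback_chain c q (Suc i) = pderiv (feedback_chain c q i) - smult (c i) q"

lemma feedback_chain_add: "feedback_chain c (q + r) i = feedback_chain c q i + feedback_chain c r i"
  by (induction i) (simp_all add: pderiv_add smult_add_right)

lemma feedback_chain_smult: "feedback_chain c (smult a q) i = smult a (feedback_chain c q i)"
  by (induction i) (simp_all add: pderiv_smult smult_diff_right mult.commute)

text \<open>
  Each step of the chain loses at most one power of \<open>X - a\<close>, exactly as repeated differentiation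
  does: the lower order terms are more divisible and disappear in the remainder \<open>s\<close>.
\<close>

lemma feedback_chain_of_multiple_of_power:
  assumes "l \<le> i"
  shows "\<exists>C s. C \<noteq> 0 \<and>
    feedback_chain c ([:-a, 1:] ^ i * q) l = [:-a, 1:] ^ (i - l) * (smult C q + [:-a, 1:] * s)"
  using assms
proof (induction l)
  case 0
  show ?case
    by (intro exI[of _ 1] exI[of _ 0]) simp
next
  case (Suc l)
  define X :: "real poly" where "X = [:-a, 1:]"
  obtain C s where C: "C \<noteq> 0" and eq: "feedback_chain c (X ^ i * q) l = X ^ (i - l) * (smult C q + X * s)"
    using Suc by (auto simp: X_def)
  obtain m where m: "i - l = Suc m" "i - Suc l = m"
    using Suc.prems by (metis Suc_diff_Suc Suc_le_lessD)
  have dX: "pderiv X = 1"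
    by (simp add: X_def pderiv_pCons)
  have i: "X ^ i = X ^ m * (X * X ^ l)"
    using m Suc.prems by (metis Suc_diff_le add.commute diff_Suc_Suc le_add_diff_inverse2 power_Suc power_add)
  have "pderiv (X ^ Suc m) = smult (real (Suc m)) (X ^ m)"
    using dX by (simp only: pderiv_power_Suc mult_1_right)
  then have "feedback_chain c (X ^ i * q) (Suc l) =
      X ^ m * (smult (real (Suc m) * C) q +
        X * (smult (real (Suc m)) s + smult C (pderiv q) + (s + X * pderiv s)
          - smult (c l) (X ^ l * q)))"
    unfolding feedback_chain.simps(2) eq m(1) pderiv_mult pderiv_add pderiv_smult dX
    unfolding i by (simp only: mult_1_left algebra_simps smult_add_right smult_diff_right
      mult_smult_left mult_smult_right smult_smult power_Suc)
  then show ?case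
    using C m(2) unfolding X_def by (metis mult_eq_0_iff nat.distinct(1) of_nat_eq_0_iff)
qed

lemma poly_feedback_chain_of_multiple_of_power:
  assumes "l < i"
  shows "poly (feedback_chain c ([:-a, 1:] ^ i * q) l) a = 0"
  using feedback_chain_of_multiple_of_power[of l i c a q] assms by (auto simp: poly_power)

lemma poly_feedback_chain_of_power_at_order:
  assumes "poly q a \<noteq> 0"
  shows "poly (feedback_chain c ([:-a, 1:] ^ i * q) i) a \<noteq> 0"
  using feedback_chain_of_multiple_of_power[of i i c a q] assms by auto

text \<open>
  Hermite interpolation adapted to the chain. The values at step \<open>i\<close> are corrected by multiples of
  \<open>X ^ i (X - 1) ^ (i + 1)\<close> and \<open>X ^ (i + 1) (X - 1) ^ i\<close>, which leave all earlier values intact;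
  each affects only one of the two end points at step \<open>i\<close>.
\<close>

lemma feedback_chain_two_point_interpolation:
  "\<exists>q. \<forall>l<i. poly (feedback_chain c q l) 0 = a l \<and> poly (feedback_chain c q l) 1 = b l"
proof (induction i)
  case (Suc i)
  then obtain q where q: "\<And>l. l < i \<Longrightarrow> poly (feedback_chain c q l) 0 = a l \<and> poly (feedback_chain c q l) 1 = b l"
    by blast
  define r :: "real poly" where "r = [:-0, 1:] ^ i * [:-1, 1:] ^ Suc i"
  define s :: "real poly" where "s = [:-1, 1:] ^ i * [:-0, 1:] ^ Suc i"
  have r': "r = [:-1, 1:] ^ Suc i * [:-0, 1:] ^ i" and s': "s = [:-0, 1:] ^ Suc i * [:-1, 1:] ^ i"
    by (simp_all only: r_def s_def mult.commute)
  have r1: "poly (feedback_chain c r l) 1 = 0" if "l \<le> i" for l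
    unfolding r' using that by (intro poly_feedback_chain_of_multiple_of_power) auto
  have s0: "poly (feedback_chain c s l) 0 = 0" if "l \<le> i" for l
    unfolding s' using that by (intro poly_feedback_chain_of_multiple_of_power) auto
  have r0: "poly (feedback_chain c r l) 0 = 0" if "l < i" for l
    unfolding r_def using that by (intro poly_feedback_chain_of_multiple_of_power) auto
  have s1: "poly (feedback_chain c s l) 1 = 0" if "l < i" for l
    unfolding s_def using that by (intro poly_feedback_chain_of_multiple_of_power) auto
  have r0': "poly (feedback_chain c r i) 0 \<noteq> 0"
    unfolding r_def by (intro poly_feedback_chain_of_power_at_order) (simp add: poly_power)
  have s1': "poly (feedback_chain c s i) 1 \<noteq> 0"
    unfolding s_def by (intro poly_feedback_chain_of_power_at_order) (simp add: poly_power)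
  let ?q = "q + smult ((a i - poly (feedback_chain c q i) 0) / poly (feedback_chain c r i) 0) r
              + smult ((b i - poly (feedback_chain c q i) 1) / poly (feedback_chain c s i) 1) s"
  have "poly (feedback_chain c ?q l) 0 = a l \<and> poly (feedback_chain c ?q l) 1 = b l" if "l < Suc i" for l
    using that q[of l] r0[of l] s1[of l] r1[of l] s0[of l] r0' s1'
    by (cases "l = i") (auto simp: feedback_chain_add feedback_chain_smult)
  then show ?case
    by blast
qed auto

lemma kalman_imp_controllable:
  fixes M :: "real ^ 'n ^ 'n" and N :: "real ^ 'p ^ 'n"
  assumes kal: "kalman_on UNIV M N"
  shows "controllable M N"
  unfolding controllable_def
proof (intro allI)
  fix x0 x1 :: "real ^ 'n"
  obtain K c where rel: "\<And>x. (((*v) M) ^^ K) x = (\<Sum>k<K. c k *\<^sub>R (((*v) M) ^^ k) x)"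
    using exists_annihilating_power_relation[of M] by blast
  define b where "b j k = (((*v) M) ^^ k) (column j N)" for j k
  obtain a0 where a0: "x0 = (\<Sum>k<K. \<Sum>j\<in>UNIV. a0 j k *\<^sub>R b j k)"
    using kalman_imp_state_decomposition[OF kal rel] unfolding b_def by blast
  obtain a1 where a1: "x1 = (\<Sum>k<K. \<Sum>j\<in>UNIV. a1 j k *\<^sub>R b j k)"
    using kalman_imp_state_decomposition[OF kal rel] unfolding b_def by blast
  (* step i leads from the coordinate of index K - Suc i to the one below it, or to the input *)
  define d where "d i = c (K - Suc i)" for i
  have "\<exists>q. \<forall>l<K. poly (feedback_chain d q l) 0 = a0 j (K - Suc l) \<and> poly (feedback_chain d q l) 1 = a1 j (K - Suc l)" for j
    by (rule feedback_chain_two_point_interpolation)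
  then obtain q where q: "\<And>j l. l < K \<Longrightarrow> poly (feedback_chain d (q j) l) 0 = a0 j (K - Suc l) \<and>
      poly (feedback_chain d (q j) l) 1 = a1 j (K - Suc l)"
    by metis
  define phi where "phi j k = feedback_chain d (q j) (K - Suc k)" for j k
  define x where "x t = (\<Sum>k<K. \<Sum>j\<in>UNIV. poly (phi j k) t *\<^sub>R b j k)" for t
  define u :: "real \<Rightarrow> real ^ 'p" where "u t = (\<chi> j. poly (feedback_chain d (q j) K) t)" for t
  have cu: "continuous_on {0..1} u"
    unfolding u_def by (intro continuous_intros continuous_on_vec_lambda)
  have ends: "x 0 = x0" "x 1 = x1"
    unfolding x_def a0 a1 by (intro sum.cong refl; simp add: phi_def q)+
  have deriv: "(x has_vector_derivative (\<Sum>k<K. \<Sum>j\<in>UNIV. poly (pderiv (phi j k)) t *\<^sub>R b j k)) (at t within S)"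
    for t S
    unfolding x_def
    by (intro has_vector_derivative_sum has_vector_derivative_scaleR[where g="\<lambda>_. b _ _" and g'=0, simplified]
        has_vector_derivative_const DERIV_subset[OF poly_DERIV]) auto
  have ode: "(\<Sum>k<K. \<Sum>j\<in>UNIV. poly (pderiv (phi j k)) t *\<^sub>R b j k) = M *v x t + N *v u t" for t
  proof -
    have Mb: "M *v b j k = b j (Suc k)" for j k
      by (simp add: b_def)
    have bK: "b j K = (\<Sum>k<K. c k *\<^sub>R b j k)" for j
      by (simp add: b_def rel)
    have Nu: "N *v u t = (\<Sum>j\<in>UNIV. poly (feedback_chain d (q j) K) t *\<^sub>R b j 0)"
      by (simp add: matrix_mult_sum u_def b_def scalar_mult_eq_scaleR)
    have Mx: "M *v x t = (\<Sum>j\<in>UNIV. \<Sum>k<K. poly (phi j k) t *\<^sub>R b j (Suc k))"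
      unfolding x_def
      by (subst sum.swap) (simp add: linear_sum[OF matrix_vector_mul_linear] matrix_vector_mult_scaleR Mb)
    have per: "(\<Sum>k<K. poly (pderiv (phi j k)) t *\<^sub>R b j k) =
        (\<Sum>k<K. poly (phi j k) t *\<^sub>R b j (Suc k)) + poly (feedback_chain d (q j) K) t *\<^sub>R b j 0" for j
    proof (cases K)
      case 0
      then show ?thesis
        using bK[of j] by simp
    next
      case (Suc L)
      have phi': "pderiv (phi j k) = feedback_chain d (q j) (K - k) + smult (c k) (q j)" if "k < K" for k
      proof -
        have "K - k = Suc (K - Suc k)"
          using that by simp
        then show ?thesis
          using that by (simp add: phi_def d_def)
      qed
      have "(\<Sum>k<K. poly (pderiv (phi j k)) t *\<^sub>R b j k)
          = (\<Sum>k<K. poly (feedback_chain d (q j) (K - k)) t *\<^sub>R b j k + poly (q j) t *\<^sub>R (c k *\<^sub>R b j k))"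
        by (intro sum.cong refl) (simp add: phi' scaleR_left_distrib mult.commute)
      also have "\<dots> = (\<Sum>k<K. poly (feedback_chain d (q j) (K - k)) t *\<^sub>R b j k) + poly (q j) t *\<^sub>R b j K"
        by (simp add: sum.distrib scaleR_sum_right bK)
      (* the power relation turns the feedback terms into the summand k = K; then the index is shifted *)
      also have "\<dots> = (\<Sum>k<Suc K. poly (feedback_chain d (q j) (K - k)) t *\<^sub>R b j k)"
        by simp
      also have "\<dots> = (\<Sum>k<K. poly (phi j k) t *\<^sub>R b j (Suc k)) + poly (feedback_chain d (q j) K) t *\<^sub>R b j 0"
        by (subst sum.lessThan_Suc_shift) (simp add: phi_def)
      finally show ?thesis .
    qed
    show ?thesis
      unfolding Nu Mx by (subst sum.swap) (simp add: per sum.distrib)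
  qed
  show "\<exists>T>0. \<exists>u x. continuous_on {0..T} u \<and> x 0 = x0 \<and> x T = x1 \<and>
      (\<forall>t\<in>{0..T}. (x has_vector_derivative M *v x t + N *v u t) (at t within {0..T}))"
    using cu ends deriv ode by (intro exI[of _ "1::real"] conjI exI[of _ u] exI[of _ x]) simp_all
qed

section \<open>Stability of the rank condition under perturbation\<close>

lemma eventually_at_right_not_in_finite:
  fixes A :: "real set"
  assumes "finite A"
  shows "\<forall>\<^sub>F e in at_right a. e \<notin> A"
proof -
  have "open (- (A - {a}))"
    using assms by (intro open_Compl finite_imp_closed) simp
  then have "\<forall>\<^sub>F e in nhds a. e \<in> - (A - {a})"
    by (rule eventually_nhds_in_open) simp
  then show ?thesis
    unfolding eventually_at_filter by (rule eventually_mono) auto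
qed

text \<open>
  Real eigenvalues are roots of the characteristic polynomial, which is obtained by evaluating the
  determinant over the ring of polynomials. It is not zero, since no eigenvalue exceeds the
  operator norm.
\<close>

lemma finite_real_eigenvalues:
  fixes f :: "real ^ 'n \<Rightarrow> real ^ 'n"
  assumes "linear f"
  shows "finite {e. \<exists>v. v \<noteq> 0 \<and> f v = e *\<^sub>R v}"
proof -
  define T where "T = matrix f"
  have T: "T *v v = f v" for v
    using assms by (simp add: T_def matrix_works linear_matrix_vector_mul_eq)
  define p where "p = det (\<chi> i j. [:T $ i $ j, - (mat 1 $ i $ j):])"
  have p: "poly p e = det (T - e *\<^sub>R mat 1)" for e
    by (simp add: p_def det_def poly_sum poly_mult poly_prod)
  have eig: "poly p e = 0 \<longleftrightarrow> (\<exists>v. v \<noteq> 0 \<and> f v = e *\<^sub>R v)" for e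
  proof -
    have "(T - e *\<^sub>R mat 1) *v v = f v - e *\<^sub>R v" for v
      by (simp add: matrix_vector_mult_diff_rdistrib T flip: scaleR_matrix_vector_assoc)
    then show ?thesis
      unfolding p using matrix_left_invertible_ker[of "T - e *\<^sub>R mat 1"]
        invertible_left_inverse[of "T - e *\<^sub>R mat 1"] invertible_det_nz[of "T - e *\<^sub>R mat 1"] by auto
  qed
  have "p \<noteq> 0"
  proof
    assume "p = 0"
    then obtain v where v: "v \<noteq> 0" "f v = (onorm f + 1) *\<^sub>R v"
      using eig[of "onorm f + 1"] by auto
    have bl: "bounded_linear f"
      using assms linear_conv_bounded_linear by blast
    have "norm (f v) \<le> onorm f * norm v"
      by (rule onorm[OF bl])
    moreover have "norm (f v) = (onorm f + 1) * norm v"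
      using v onorm_pos_le[OF bl] by simp
    ultimately show False
      using v(1) by (simp add: algebra_simps)
  qed
  then have "finite {e. poly p e = 0}"
    by (rule poly_roots_finite)
  then show ?thesis
    by (simp add: eig)
qed

text \<open>
  The condition says that no unit covector on \<open>X\<close> is annihilated by all the \<open>M ^ k N\<close>. For each
  covector this is an open condition on \<open>(e, v)\<close> jointly, so compactness of the unit sphere gives
  a neighbourhood of \<open>e = 0\<close> that works for all of them (tube lemma).
\<close>

lemma kalman_on_perturb:
  fixes M P :: "real ^ 'n ^ 'n" and N Q :: "real ^ 'p ^ 'n"
  assumes kal: "kalman_on X M N"
  shows "\<forall>\<^sub>F e in at_right 0. kalman_on X (M + e *\<^sub>R P) (N + e *\<^sub>R Q)"
proof -
  define g where "g k z = ((\<lambda>w. w v* (M + fst z *\<^sub>R P)) ^^ k) (snd z) v* (N + fst z *\<^sub>R Q)" for k and z :: "real \<times> (real ^ 'n)"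
  have cv: "continuous_on UNIV (\<lambda>z. a z v* (A + fst z *\<^sub>R B))"
    if "continuous_on UNIV a" for a :: "real \<times> (real ^ 'n) \<Rightarrow> real ^ 'n" and A B :: "real ^ 'q ^ 'n"
    unfolding vector_matrix_mult_def
    by (intro continuous_intros continuous_on_vec_lambda that)
  have it: "continuous_on UNIV (\<lambda>z. ((\<lambda>w. w v* (M + fst z *\<^sub>R P)) ^^ k) (snd z))" for k
    by (induction k) (auto intro: continuous_intros cv)
  have cg: "continuous_on UNIV (g k)" for k
    unfolding g_def by (intro cv it)
  define W where "W = (\<Union>k. g k -` (- {0}))"
  have "open W"
    unfolding W_def using cg by (intro open_UN ballI open_vimage) (auto simp: open_Compl)
  define C where "C = {v :: real ^ 'n. (\<forall>i. i \<notin> X \<longrightarrow> v $ i = 0) \<and> norm v = 1}"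
  have "C = (\<Inter>i\<in>-X. {v. v $ i = 0}) \<inter> sphere 0 1"
    by (auto simp: C_def)
  moreover have "closed {v :: real ^ 'n. v $ i = 0}" for i
    by (intro closed_Collect_eq continuous_intros)
  ultimately have "compact C"
    by (auto intro!: closed_Int_compact closed_INT)
  have "{0} \<times> C \<subseteq> W"
  proof clarify
    fix v assume v: "v \<in> C"
    then have "v \<noteq> 0"
      by (auto simp: C_def)
    then obtain k where "((\<lambda>w. w v* M) ^^ k) v v* N \<noteq> 0"
      using kal v unfolding kalman_on_def C_def by blast
    then show "(0, v) \<in> W"
      by (auto simp: W_def g_def)
  qed
  then obtain X0 where X0: "0 \<in> X0" "open X0" "X0 \<times> C \<subseteq> W"
    using Elementary_Topology.tube_lemma[OF \<open>compact C\<close> \<open>open W\<close>] by blast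
  have good: "kalman_on X (M + e *\<^sub>R P) (N + e *\<^sub>R Q)" if "e \<in> X0" for e
    unfolding kalman_on_def
  proof (intro allI impI)
    fix v :: "real ^ 'n"
    assume sup: "\<forall>i. i \<notin> X \<longrightarrow> v $ i = 0"
      and ann: "\<forall>k. ((\<lambda>w. w v* (M + e *\<^sub>R P)) ^^ k) v v* (N + e *\<^sub>R Q) = 0"
    show "v = 0"
    proof (rule ccontr)
      assume "v \<noteq> 0"
      define s where "s = inverse (norm v)"
      have "s *\<^sub>R v \<in> C"
        using sup \<open>v \<noteq> 0\<close> by (auto simp: C_def s_def)
      then have "(e, s *\<^sub>R v) \<in> W"
        using X0 that by blast
      then obtain k where "g k (e, s *\<^sub>R v) \<noteq> 0"
        by (auto simp: W_def)
      moreover have "((\<lambda>w. w v* A) ^^ k) (s *\<^sub>R v) = s *\<^sub>R ((\<lambda>w. w v* A) ^^ k) v" for A :: "real ^ 'n ^ 'n"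
        by (induction k) (simp_all add: scaleR_vector_matrix_assoc)
      ultimately show False
        using ann by (simp add: g_def scaleR_vector_matrix_assoc)
    qed
  qed
  have "\<forall>\<^sub>F e in at_right 0. e \<in> X0"
    using X0 eventually_nhds_in_open[of X0 0] by (auto simp: eventually_at_filter elim: eventually_mono)
  then show ?thesis
    by (rule eventually_mono) (rule good)
qed

section \<open>Removing a state from a reachable and matched graph\<close>

text \<open>
  Edges are pairs of a left vertex (an input or a state) and a right vertex, as in the system
  bipartite graph; paths use states of \<open>X\<close> only.
\<close>

inductive_set input_reachable :: "(('p + 'n) \<times> 'n) set \<Rightarrow> 'n set \<Rightarrow> 'n set"
  for G X where
  from_input: "(Inl u, x) \<in> G \<Longrightarrow> x \<in> X \<Longrightarrow> x \<in> input_reachable G X"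
| from_state: "y \<in> input_reachable G X \<Longrightarrow> (Inr y, x) \<in> G \<Longrightarrow> x \<in> X \<Longrightarrow> x \<in> input_reachable G X"

lemma input_reachable_subset: "input_reachable G X \<subseteq> X"
  by (auto elim: input_reachable.cases)

text \<open>
  A matching that covers the right vertices in \<open>X\<close>, given by the partner of each of them; the
  partners are inputs or states in \<open>Y\<close>. Restricting \<open>Y\<close> leaves states free on the left side.
\<close>

definition matches :: "(('p + 'n) \<times> 'n) set \<Rightarrow> 'n set \<Rightarrow> 'n set \<Rightarrow> ('n \<Rightarrow> 'p + 'n) \<Rightarrow> bool"
  where "matches G X Y f \<longleftrightarrow> inj_on f X \<and> (\<forall>x\<in>X. (f x, x) \<in> G \<and> f x \<in> range Inl \<union> Inr ` Y)"

text \<open>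
  If the partners do not exhaust \<open>X\<close>, a state is free already. Otherwise no input is a partner, and
  rematching the end point of any edge from an input frees its old partner.
\<close>

lemma matching_can_free_a_state:
  fixes G :: "(('p + 'n :: finite) \<times> 'n) set"
  assumes X: "X \<noteq> {}" "X \<subseteq> input_reachable G X" and f: "matches G X X f"
  shows "\<exists>m\<in>X. \<exists>f. matches G X (X - {m}) f"
proof (cases "Inr ` X \<subseteq> f ` X")
  case True
  have inj: "inj_on f X"
    using f by (simp add: matches_def)
  have "card (Inr ` X :: ('p + 'n) set) = card (f ` X)"
    using inj by (simp add: card_image)
  then have img: "f ` X = Inr ` X"
    using True by (metis card_subset_eq finite_class.finite_UNIV finite_imageI finite_subset subset_UNIV)
  have "\<exists>u c. (Inl u, c) \<in> G \<and> c \<in> X"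
  proof -
    obtain x where "x \<in> input_reachable G X"
      using X by blast
    then show ?thesis
      by induction auto
  qed
  then obtain u c where c: "(Inl u, c) \<in> G" "c \<in> X"
    by blast
  then obtain m where m: "f c = Inr m" "m \<in> X"
    using img by blast
  have "Inl u \<notin> f ` X"
    unfolding img by blast
  then have "inj_on (f(c := Inl u)) X"
    using inj by (simp add: inj_on_fun_updI)
  moreover have "f x \<in> Inr ` (X - {m})" if "x \<in> X" "x \<noteq> c" for x
  proof -
    have "f x \<noteq> Inr m"
      using inj m(1) c(2) that by (metis inj_onD)
    moreover have "f x \<in> Inr ` X"
      using img that by blast
    ultimately show ?thesis
      by blast
  qed
  moreover have "(f x, x) \<in> G" if "x \<in> X" for x
    using f that unfolding matches_def by simp
  ultimately have "matches G X (X - {m}) (f(c := Inl u))"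
    using c(1) unfolding matches_def by simp
  then show ?thesis
    using m(2) by blast
next
  case False
  then obtain m where m: "m \<in> X" "Inr m \<notin> f ` X"
    by blast
  moreover have "f x \<in> range Inl \<union> Inr ` (X - {m})" if "x \<in> X" for x
  proof -
    have "f x \<noteq> Inr m"
      using m(2) that by (metis imageI)
    moreover have "f x \<in> range Inl \<union> Inr ` X"
      using f that unfolding matches_def by simp
    ultimately show ?thesis
      by auto
  qed
  ultimately have "matches G X (X - {m}) f"
    using f unfolding matches_def by simp
  then show ?thesis
    using m(1) by blast
qed

text \<open>
  Among the states that some matching leaves free on the left, let \<open>m\<close> be one whose removal keeps
  the most states reachable. Suppose that it cuts off some state. Then it has an edge to a cut off
  state \<open>y\<close>, whose partner \<open>z\<close> must also be cut off, as otherwise \<open>y\<close> would be reached through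
  \<open>z\<close>. Rematching \<open>y\<close> with \<open>m\<close> frees \<open>z\<close>. Removing \<open>z\<close> instead keeps everything that is
  reachable without \<open>m\<close>, since such paths avoid \<open>z\<close>, and it also keeps \<open>m\<close>: this contradicts the
  choice of \<open>m\<close>.
\<close>

lemma exists_removable_state:
  fixes G :: "(('p + 'n :: finite) \<times> 'n) set"
  assumes X: "X \<noteq> {}" "X \<subseteq> input_reachable G X" and f: "matches G X X f"
  shows "\<exists>m\<in>X. X - {m} \<subseteq> input_reachable G (X - {m}) \<and> (\<exists>f. matches G X (X - {m}) f)"
proof -
  let ?free = "\<lambda>m. m \<in> X \<and> (\<exists>f. matches G X (X - {m}) f)"
  let ?R = "\<lambda>m. input_reachable G (X - {m})"
  obtain m where m: "?free m" and max: "\<And>z. ?free z \<Longrightarrow> card (?R z) \<le> card (?R m)"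
  proof -
    obtain m0 where "?free m0"
      using matching_can_free_a_state[OF assms] by blast
    moreover have "\<forall>z. ?free z \<longrightarrow> card (?R z) < Suc CARD('n)"
      by (intro allI impI le_imp_less_Suc card_mono) auto
    ultimately show ?thesis
      using that ex_has_greatest_nat[of ?free m0 "\<lambda>z. card (?R z)" "Suc CARD('n)"] by blast
  qed
  then obtain f where f: "matches G X (X - {m}) f"
    by blast
  have "X - {m} \<subseteq> ?R m"
  proof (rule ccontr)
    assume notall: "\<not> X - {m} \<subseteq> ?R m"
    have "\<exists>y. y \<in> X - {m} - ?R m \<and> (Inr m, y) \<in> G"
    proof (rule ccontr)
      assume no: "\<not> ?thesis"
      have "x \<in> insert m (?R m)" if "x \<in> input_reachable G X" for x
        using that
      proof induction
        case (from_input u x)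
        then show ?case
          using input_reachable.from_input[of u x G "X - {m}"] by blast
      next
        case (from_state y x)
        then show ?case
          using no input_reachable.from_state[of y G "X - {m}" x] by blast
      qed
      then show False
        using notall X(2) by blast
    qed
    then obtain y where y: "y \<in> X" "y \<noteq> m" "y \<notin> ?R m" "(Inr m, y) \<in> G"
      by blast
    have fy: "(f y, y) \<in> G" "f y \<in> range Inl \<union> Inr ` (X - {m})"
      using f y(1) unfolding matches_def by auto
    moreover have "(Inl u, y) \<notin> G" for u
      using y input_reachable.from_input[of u y G "X - {m}"] by blast
    ultimately obtain z where z: "f y = Inr z" "z \<in> X" "z \<noteq> m"
      by auto
    have zR: "z \<notin> ?R m"
      using y z fy(1) input_reachable.from_state[of z G "X - {m}" y] by auto
    have "?free z"
    proof -
      have inj: "inj_on f X" and fX: "\<And>x. x \<in> X \<Longrightarrow> (f x, x) \<in> G \<and> f x \<in> range Inl \<union> Inr ` (X - {m})"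
        using f unfolding matches_def by auto
      have "Inr m \<notin> f ` X"
      proof
        assume "Inr m \<in> f ` X"
        then obtain x where "x \<in> X" "f x = Inr m"
          by (metis imageE)
        then show False
          using fX[of x] by auto
      qed
      then have "inj_on (f(y := Inr m)) X"
        using inj by (simp add: inj_on_fun_updI)
      moreover have "f x \<in> range Inl \<union> Inr ` (X - {z})" if "x \<in> X" "x \<noteq> y" for x
      proof -
        have "f x \<noteq> Inr z"
          using inj z(1) y(1) that by (metis inj_onD)
        then show ?thesis
          using fX[OF that(1)] by (cases "f x") auto
      qed
      ultimately have "matches G X (X - {z}) (f(y := Inr m))"
        using fX y(4) m z(3) unfolding matches_def by simp
      then show ?thesis
        using z(2) by blast
    qed
    moreover have "insert m (?R m) \<subseteq> ?R z"
    proof -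
      have sub: "?R m \<subseteq> ?R z"
      proof
        fix x
        assume "x \<in> ?R m"
        then show "x \<in> ?R z"
        proof induction
          case (from_input u x)
          then have "x \<noteq> z"
            using zR input_reachable.from_input[of u x G "X - {m}"] by blast
          then show ?case
            using from_input input_reachable.from_input[of u x G "X - {z}"] by blast
        next
          case (from_state y x)
          then have "x \<noteq> z"
            using zR input_reachable.from_state[of y G "X - {m}" x] by blast
          then show ?case
            using from_state input_reachable.from_state[of y G "X - {z}" x] by blast
        qed
      qed
      (* the last step of a path to m that visits m only at its end *)
      have "(\<exists>u. (Inl u, m) \<in> G) \<or> (\<exists>x\<in>?R m. (Inr x, m) \<in> G)"
      proof (rule ccontr)
        assume no: "\<not> ?thesis"
        have "x \<in> ?R m" if "x \<in> input_reachable G X" for x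
          using that
        proof induction
          case (from_input u x)
          then show ?case
            using no input_reachable.from_input[of u x G "X - {m}"] by blast
        next
          case (from_state y x)
          then show ?case
            using no input_reachable.from_state[of y G "X - {m}" x] by blast
        qed
        then show False
          using m X(2) input_reachable_subset[of G "X - {m}"] by blast
      qed
      then have "m \<in> ?R z"
        using m z(3) sub input_reachable.from_input[of _ m G "X - {z}"]
          input_reachable.from_state[of _ G "X - {z}" m] by blast
      then show ?thesis
        using sub by blast
    qed
    moreover have "m \<notin> ?R m"
      using input_reachable_subset[of G "X - {m}"] by blast
    ultimately have "card (?R m) < card (?R z)"
      by (intro psubset_card_mono) auto
    then show False
      using max[OF \<open>?free z\<close>] by simp
  qed
  then show ?thesis
    using m by blast
qed

section \<open>Sufficiency of Lin's criterion\<close>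

definition weights_on :: "(('p + 'n) \<times> 'n) set \<Rightarrow> 'n set \<Rightarrow> real ^ 'n ^ 'n \<Rightarrow> real ^ 'p ^ 'n \<Rightarrow> bool"
  where "weights_on G X M N \<longleftrightarrow>
    (\<forall>i j. M $ i $ j \<noteq> 0 \<longrightarrow> i \<in> X \<and> j \<in> X \<and> (Inr j, i) \<in> G) \<and>
    (\<forall>i u. N $ i $ u \<noteq> 0 \<longrightarrow> i \<in> X \<and> (Inl u, i) \<in> G)"

text \<open>
  The old weights vanish on the edges at \<open>m\<close>, and the matching uses no edge leaving \<open>m\<close>, so column
  \<open>m\<close> of the new state matrix is zero. Thus \<open>v M\<close> lives on \<open>X - {m}\<close>, where the perturbed pair
  still satisfies the rank condition. The remaining equations \<open>v M = 0\<close> and \<open>v N = 0\<close>, read in the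
  column of the partner of \<open>i\<close> for each \<open>i \<in> X\<close>, say that \<open>v\<close> is an eigenvector of a linear map
  \<open>T\<close> depending on the old weights only, with eigenvalue \<open>- e\<close>.
\<close>

lemma kalman_on_add_state:
  fixes M :: "real ^ 'n ^ 'n" and N :: "real ^ 'p ^ 'n"
  assumes f: "matches G X (X - {m}) f"
    and w: "weights_on G (X - {m}) M N" and kal: "kalman_on (X - {m}) M N"
  shows "\<exists>M N. weights_on G X M N \<and> kalman_on X M N"
proof -
  define P :: "real ^ 'n ^ 'n" where "P = (\<chi> i j. if i \<in> X \<and> f i = Inr j then 1 else 0)"
  define Q :: "real ^ 'p ^ 'n" where "Q = (\<chi> i u. if i \<in> X \<and> f i = Inl u then 1 else 0)"
  define T where "T v = (\<chi> i. if i \<in> X then case f i of Inl u \<Rightarrow> (v v* N) $ u | Inr j \<Rightarrow> (v v* M) $ j else 0)"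
    for v
  have inj: "inj_on f X" and fX: "\<And>x. x \<in> X \<Longrightarrow> (f x, x) \<in> G \<and> f x \<in> range Inl \<union> Inr ` (X - {m})"
    using f unfolding matches_def by auto
  have "linear T"
    by (rule linearI) (auto simp: T_def vec_eq_iff vector_matrix_left_distrib scaleR_vector_matrix_assoc
        split: sum.split)
  then have fin: "finite (uminus ` {e. \<exists>v. v \<noteq> 0 \<and> T v = e *\<^sub>R v})"
    by (intro finite_imageI finite_real_eigenvalues)
  have "\<forall>\<^sub>F e in at_right 0. kalman_on (X - {m}) (M + e *\<^sub>R P) (N + e *\<^sub>R Q) \<and>
      e \<notin> uminus ` {e. \<exists>v. v \<noteq> 0 \<and> T v = e *\<^sub>R v}"
    by (intro eventually_conj kalman_on_perturb kal eventually_at_right_not_in_finite fin)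
  then obtain e where e: "kalman_on (X - {m}) (M + e *\<^sub>R P) (N + e *\<^sub>R Q)"
      "e \<notin> uminus ` {e. \<exists>v. v \<noteq> 0 \<and> T v = e *\<^sub>R v}"
    using eventually_happens'[OF trivial_limit_at_right_real] by blast
  define M1 where "M1 = M + e *\<^sub>R P"
  define N1 where "N1 = N + e *\<^sub>R Q"
  have M0: "M1 $ i $ j = 0" if "j \<notin> X - {m}" for i j
  proof -
    have "M $ i $ j = 0"
      using w that unfolding weights_on_def by blast
    moreover have "P $ i $ j = 0"
      using fX[of i] that by (auto simp: P_def)
    ultimately show ?thesis
      by (simp add: M1_def)
  qed
  have "weights_on G X M1 N1"
    unfolding weights_on_def
  proof (intro conjI allI impI)
    fix i j
    assume nz: "M1 $ i $ j \<noteq> 0"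
    then show "j \<in> X"
      using M0 by blast
    from nz have "M $ i $ j \<noteq> 0 \<or> P $ i $ j \<noteq> 0"
      by (auto simp: M1_def)
    then show "i \<in> X" "(Inr j, i) \<in> G"
      using w fX[of i] by (auto simp: weights_on_def P_def split: if_splits)
  next
    fix i u
    assume nz: "N1 $ i $ u \<noteq> 0"
    then have "N $ i $ u \<noteq> 0 \<or> Q $ i $ u \<noteq> 0"
      by (auto simp: N1_def)
    then show "i \<in> X" "(Inl u, i) \<in> G"
      using w fX[of i] by (auto simp: weights_on_def Q_def split: if_splits)
  qed
  moreover have "kalman_on X M1 N1"
    unfolding kalman_on_def
  proof (intro allI impI)
    fix v :: "real ^ 'n"
    assume sup: "\<forall>i. i \<notin> X \<longrightarrow> v $ i = 0" and ann: "\<forall>k. ((\<lambda>w. w v* M1) ^^ k) v v* N1 = 0"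
    have "((\<lambda>w. w v* M1) ^^ k) (v v* M1) v* N1 = 0" for k
      using ann[rule_format, of "Suc k"] by (simp only: funpow_Suc_right o_apply)
    moreover have "(v v* M1) $ j = 0" if "j \<notin> X - {m}" for j
      using M0[OF that] by (simp add: vector_matrix_mult_def)
    ultimately have vM: "v v* M1 = 0"
      using e(1) unfolding kalman_on_def M1_def[symmetric] N1_def[symmetric] by blast
    have vN: "v v* N1 = 0"
      using ann[rule_format, of 0] by simp
    have vP: "(v v* P) $ j = v $ i" if "i \<in> X" "f i = Inr j" for i j
    proof -
      have "P $ i' $ j * v $ i' = (if i' = i then v $ i' else 0)" for i'
        using that inj by (auto simp: P_def) (metis inj_onD)
      then have "(\<Sum>i'\<in>UNIV. P $ i' $ j * v $ i') = v $ i"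
        by simp
      then show ?thesis
        by (simp add: vector_matrix_mult_def mult.commute)
    qed
    have vQ: "(v v* Q) $ u = v $ i" if "i \<in> X" "f i = Inl u" for i u
    proof -
      have "Q $ i' $ u * v $ i' = (if i' = i then v $ i' else 0)" for i'
        using that inj by (auto simp: Q_def) (metis inj_onD)
      then have "(\<Sum>i'\<in>UNIV. Q $ i' $ u * v $ i') = v $ i"
        by simp
      then show ?thesis
        by (simp add: vector_matrix_mult_def mult.commute)
    qed
    have Tv: "T v = (- e) *\<^sub>R v"
    proof (rule vec_eq_iff[THEN iffD2], rule allI)
      fix i
      have "(v v* M) $ j = - e * (v v* P) $ j" for j
        using vM by (simp add: M1_def vector_matrix_mult_add_rdistrib vector_scaleR_matrix_ac vec_eq_iff eq_neg_iff_add_eq_0)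
      moreover have "(v v* N) $ u = - e * (v v* Q) $ u" for u
        using vN by (simp add: N1_def vector_matrix_mult_add_rdistrib vector_scaleR_matrix_ac vec_eq_iff eq_neg_iff_add_eq_0)
      ultimately show "T v $ i = ((- e) *\<^sub>R v) $ i"
        using sup vP[of i] vQ[of i] by (auto simp: T_def split: sum.split)
    qed
    show "v = 0"
    proof (rule ccontr)
      assume "v \<noteq> 0"
      then have "- e \<in> {e. \<exists>v. v \<noteq> 0 \<and> T v = e *\<^sub>R v}"
        using Tv by blast
      then have "- (- e) \<in> uminus ` {e. \<exists>v. v \<noteq> 0 \<and> T v = e *\<^sub>R v}"
        by (rule imageI)
      then show False
        using e(2) by simp
    qed
  qed
  ultimately show ?thesis
    by blast
qed

lemma reachable_matched_imp_kalman_on: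
  fixes G :: "(('p :: finite + 'n :: finite) \<times> 'n) set"
  assumes "X \<subseteq> input_reachable G X" and "matches G X X f"
  shows "\<exists>(M :: real ^ 'n ^ 'n) (N :: real ^ 'p ^ 'n). weights_on G X M N \<and> kalman_on X M N"
  using finite[of X] assms
proof (induction X arbitrary: f rule: finite_psubset_induct)
  case (psubset X)
  show ?case
  proof (cases "X = {}")
    case True
    then have "kalman_on X (0 :: real ^ 'n ^ 'n) (0 :: real ^ 'p ^ 'n)"
      by (auto simp: kalman_on_def vec_eq_iff)
    then show ?thesis
      by (intro exI[of _ 0]) (auto simp: weights_on_def)
  next
    case False
    then obtain m f' where m: "m \<in> X" "X - {m} \<subseteq> input_reachable G (X - {m})" "matches G X (X - {m}) f'"
      using exists_removable_state[OF False psubset.prems] by blast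
    then have "matches G (X - {m}) (X - {m}) f'"
      unfolding matches_def using inj_on_subset[of f' X "X - {m}"] by blast
    then obtain M :: "real ^ 'n ^ 'n" and N :: "real ^ 'p ^ 'n"
      where "weights_on G (X - {m}) M N" "kalman_on (X - {m}) M N"
      using psubset.IH[of "X - {m}"] m by blast
    then show ?thesis
      using kalman_on_add_state m(3) by blast
  qed
qed

text \<open>
  A small multiple of the pattern \<open>b\<close> makes exactly the missing entries nonzero and cancels none of
  the existing ones.
\<close>

lemma eventually_fill_pattern:
  fixes a b :: real
  assumes "a \<noteq> 0 \<Longrightarrow> b \<noteq> 0"
  shows "\<forall>\<^sub>F e in at_right 0. a + e * b = 0 \<longleftrightarrow> b = 0"
proof (cases "b = 0")
  case False
  have "\<forall>\<^sub>F e in at_right 0. e \<notin> {- a / b}"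
    by (rule eventually_at_right_not_in_finite) simp
  then show ?thesis
    by (rule eventually_mono) (use False in \<open>auto simp: field_simps add_eq_0_iff\<close>)
qed (use assms in auto)

lemma system_bipartite_edges_iff [simp]:
  "(Inr j, i) \<in> system_bipartite_edges S R \<longleftrightarrow> S $ i $ j = 1"
  "(Inl u, i) \<in> system_bipartite_edges S R \<longleftrightarrow> R $ i $ u = 1"
  by (auto simp: system_bipartite_edges_def)

theorem reachable_matched_imp_structurally_controllable:
  fixes S :: "bit ^ 'n ^ 'n" and R :: "bit ^ 'p ^ 'n"
  assumes reach: "input_reachable (system_bipartite_edges S R) UNIV = UNIV"
    and f: "matches (system_bipartite_edges S R) UNIV UNIV f"
  shows "structurally_controllable S R"
proof -
  obtain M :: "real ^ 'n ^ 'n" and N :: "real ^ 'p ^ 'n"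
    where w: "weights_on (system_bipartite_edges S R) UNIV M N" and kal: "kalman_on UNIV M N"
    using reachable_matched_imp_kalman_on[OF _ f] reach by blast
  define P :: "real ^ 'n ^ 'n" where "P = (\<chi> i j. if S $ i $ j = 1 then 1 else 0)"
  define Q :: "real ^ 'p ^ 'n" where "Q = (\<chi> i u. if R $ i $ u = 1 then 1 else 0)"
  have "\<forall>\<^sub>F e in at_right 0. kalman_on UNIV (M + e *\<^sub>R P) (N + e *\<^sub>R Q) \<and>
      (\<forall>i j. M $ i $ j + e * P $ i $ j = 0 \<longleftrightarrow> P $ i $ j = 0) \<and>
      (\<forall>i u. N $ i $ u + e * Q $ i $ u = 0 \<longleftrightarrow> Q $ i $ u = 0)"
    using w by (intro eventually_conj kalman_on_perturb kal eventually_all_finite eventually_fill_pattern)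
      (auto simp: weights_on_def P_def Q_def)
  then obtain e where e: "kalman_on UNIV (M + e *\<^sub>R P) (N + e *\<^sub>R Q)"
      "\<And>i j. M $ i $ j + e * P $ i $ j = 0 \<longleftrightarrow> P $ i $ j = 0"
      "\<And>i u. N $ i $ u + e * Q $ i $ u = 0 \<longleftrightarrow> Q $ i $ u = 0"
    using eventually_happens'[OF trivial_limit_at_right_real] by blast
  have "same_sparsity (M + e *\<^sub>R P) S" "same_sparsity (N + e *\<^sub>R Q) R"
    using e(2,3) by (auto simp: same_sparsity_def P_def Q_def)
  then show ?thesis
    using kalman_imp_controllable[OF e(1)] unfolding structurally_controllable_def by blast
qed

lemma matching_imp_matches:
  assumes F: "bipartite_matching G F" "\<nexists>v. right_unmatched F v"
  shows "\<exists>f. matches G UNIV UNIV f"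
proof -
  have "\<forall>v. \<exists>l. (l, v) \<in> F"
    using F(2) unfolding right_unmatched_def by (metis prod.collapse)
  then obtain f where f: "\<And>v. (f v, v) \<in> F"
    by metis
  have "inj f"
    using F(1) f unfolding bipartite_matching_def by (intro injI) (metis fst_conv snd_conv)
  moreover have "(f v, v) \<in> G" for v
    using F(1) f[of v] unfolding bipartite_matching_def by blast
  moreover have "f v \<in> range Inl \<union> Inr ` UNIV" for v
    by (cases "f v") simp_all
  ultimately have "matches G UNIV UNIV f"
    unfolding matches_def by blast
  then show ?thesis
    by blast
qed

section \<open>Necessity of reachability\<close>

text \<open>
  The states \<open>U\<close> that no input reaches receive nothing from the other states or the inputs, so their
  part \<open>y\<close> of a trajectory satisfies \<open>(y \<bullet> y)' \<le> 2 K (y \<bullet> y)\<close>. Gronwall's argument shows that it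
  stays at \<open>0\<close> if it starts there.
\<close>

lemma structurally_controllable_imp_input_reachable:
  fixes S :: "bit ^ 'n ^ 'n" and R :: "bit ^ 'p ^ 'n"
  assumes "structurally_controllable S R"
  shows "input_reachable (system_bipartite_edges S R) UNIV = UNIV"
proof (rule ccontr)
  define U where "U = - input_reachable (system_bipartite_edges S R) UNIV"
  assume "\<not> ?thesis"
  then obtain i0 where i0: "i0 \<in> U"
    by (auto simp: U_def)
  obtain M :: "real ^ 'n ^ 'n" and N :: "real ^ 'p ^ 'n"
    where spM: "same_sparsity M S" and spN: "same_sparsity N R" and con: "controllable M N"
    using assms unfolding structurally_controllable_def by blast
  have N0: "N $ i $ u = 0" if "i \<in> U" for i u
  proof -
    have "\<not> R $ i $ u = 1"
      using that input_reachable.from_input[of u i "system_bipartite_edges S R" UNIV] unfolding U_def system_bipartite_edges_iff by blast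
    then show ?thesis
      using spN by (simp add: same_sparsity_def)
  qed
  have M0: "M $ i $ j = 0" if "i \<in> U" "j \<notin> U" for i j
  proof -
    have "\<not> S $ i $ j = 1"
      using that input_reachable.from_state[of j "system_bipartite_edges S R" UNIV i] unfolding U_def system_bipartite_edges_iff by blast
    then show ?thesis
      using spM by (simp add: same_sparsity_def)
  qed
  obtain T u x where T: "T > 0" and x0: "x 0 = (0 :: real ^ 'n)" and xT: "x T = axis i0 1"
    and ode: "\<And>t. t \<in> {0..T} \<Longrightarrow> (x has_vector_derivative M *v x t + N *v u t) (at t within {0..T})"
    using con[unfolded controllable_def, THEN spec, THEN spec, of 0 "axis i0 1"] by blast
  define pr :: "real ^ 'n \<Rightarrow> real ^ 'n" where "pr z = (\<chi> i. if i \<in> U then z $ i else 0)" for z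
  have pr: "bounded_linear pr"
    by (intro linear_conv_bounded_linear[THEN iffD1] linearI) (auto simp: pr_def vec_eq_iff)
  define K where "K = onorm ((*v) M)"
  define y where "y t = pr (x t)" for t
  have dy: "(y has_vector_derivative pr (M *v x t + N *v u t)) (at t within {0..T})" if "t \<in> {0..T}" for t
    unfolding y_def by (rule bounded_linear.has_vector_derivative[OF pr ode[OF that]])
  have prMN: "pr (M *v x t + N *v u t) = pr (M *v y t)" for t
    unfolding vec_eq_iff
  proof
    fix i
    have "M $ i $ j * x t $ j = M $ i $ j * y t $ j" if "i \<in> U" for j
      using M0[OF that] by (cases "j \<in> U") (auto simp: y_def pr_def)
    then have "(\<Sum>j\<in>UNIV. M $ i $ j * x t $ j) = (\<Sum>j\<in>UNIV. M $ i $ j * y t $ j)" if "i \<in> U"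
      using that by (intro sum.cong) auto
    then show "pr (M *v x t + N *v u t) $ i = pr (M *v y t) $ i"
      using N0 by (simp add: pr_def matrix_vector_mult_def)
  qed
  have prin: "y t \<bullet> pr z = y t \<bullet> z" for t z
    by (auto simp: y_def pr_def inner_vec_def intro!: sum.cong)
  have growth: "y t \<bullet> pr (M *v x t + N *v u t) \<le> K * (y t \<bullet> y t)" for t
  proof -
    have "y t \<bullet> (M *v y t) \<le> norm (y t) * norm (M *v y t)"
      by (rule norm_cauchy_schwarz)
    also have "\<dots> \<le> norm (y t) * (K * norm (y t))"
      unfolding K_def by (intro mult_left_mono onorm matrix_vector_mul_bounded_linear) auto
    also have "\<dots> = K * (y t \<bullet> y t)"
      by (simp add: dot_square_norm power2_eq_square)
    finally show ?thesis
      by (simp add: prMN prin)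
  qed
  define g where "g t = exp (- (2 * K * t)) * (y t \<bullet> y t)" for t
  have dg: "(g has_real_derivative exp (- (2 * K * t)) *
      (2 * (y t \<bullet> pr (M *v x t + N *v u t)) - 2 * K * (y t \<bullet> y t))) (at t within {0..T})"
    if "t \<in> {0..T}" for t
  proof -
    have inner: "((\<lambda>t. y t \<bullet> y t) has_real_derivative 2 * (y t \<bullet> pr (M *v x t + N *v u t))) (at t within {0..T})"
      using bounded_bilinear.has_vector_derivative[OF bounded_bilinear_inner dy[OF that] dy[OF that]]
      by (simp add: has_real_derivative_iff_has_vector_derivative inner_commute)
    have "((\<lambda>t. exp (- (2 * K * t))) has_real_derivative - (2 * K) * exp (- (2 * K * t))) (at t within {0..T})"
      by (auto intro!: derivative_eq_intros)
    from DERIV_mult[OF this inner] show ?thesis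
      unfolding g_def by (rule DERIV_cong) (simp add: algebra_simps)
  qed
  have "g T \<le> g 0"
  proof (rule DERIV_nonpos_imp_decreasing_open[where f = g])
    show "0 \<le> T"
      using T by simp
    show "\<exists>d. DERIV g t :> d \<and> d \<le> 0" if t: "0 < t" "t < T" for t
    proof (intro exI conjI)
      show "(g has_real_derivative exp (- (2 * K * t)) *
          (2 * (y t \<bullet> pr (M *v x t + N *v u t)) - 2 * K * (y t \<bullet> y t))) (at t)"
        using dg[of t] t unfolding at_within_Icc_at[OF t] by simp
      show "exp (- (2 * K * t)) *
          (2 * (y t \<bullet> pr (M *v x t + N *v u t)) - 2 * K * (y t \<bullet> y t)) \<le> 0"
        using growth[of t] by (intro mult_nonneg_nonpos) simp_all
    qed
    show "continuous_on {0..T} g"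
      by (rule DERIV_continuous_on) (rule dg)
  qed
  moreover have "y 0 = 0"
    using x0 by (simp add: y_def linear_0[OF bounded_linear.linear[OF pr]])
  ultimately have "y T \<bullet> y T \<le> 0"
    by (simp add: g_def mult_le_0_iff)
  then have "y T = 0"
    by (metis inner_gt_zero_iff not_less)
  then have "y T $ i0 = 0"
    by simp
  then show False
    using i0 by (simp add: y_def pr_def xT axis_def)
qed

section \<open>Reachability in composed systems\<close>

lemma composed_dynamics_eq_1_iff:
  "composed_dynamics A' H E $ (i, a) $ (j, b) = 1 \<longleftrightarrow>
    i = j \<and> A' $ a $ b = 1 \<or> E $ i $ j = 1 \<and> H $ a $ b = 1"
  by (cases "A' $ a $ b"; cases "E $ i $ j"; cases "H $ a $ b")
    (auto simp: composed_dynamics_def matrix_or_def kronecker_def mat_def)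

lemma composed_input_eq_1_iff:
  "composed_input B' $ (i, a) $ (j, u) = 1 \<longleftrightarrow> i = j \<and> B' $ a $ u = 1"
  by (auto simp: composed_input_def kronecker_def mat_def)

lemma matrix_or_eq_1_iff: "(A' \<or>\<^sub>m H) $ a $ b = 1 \<longleftrightarrow> A' $ a $ b = 1 \<or> H $ a $ b = 1"
  by (cases "A' $ a $ b"; cases "H $ a $ b") (auto simp: matrix_or_def)

lemma composed_reachable_imp_component_reachable:
  assumes "ia \<in> input_reachable (system_bipartite_edges (composed_dynamics A' H E) (composed_input B')) UNIV"
  shows "snd ia \<in> input_reachable (system_bipartite_edges (A' \<or>\<^sub>m H) B') UNIV"
  using assms
proof induction
  case (from_input u x)
  obtain j b i a where "u = (j, b)" "x = (i, a)"
    by (metis surj_pair)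
  with from_input show ?case
    by (auto simp: composed_input_eq_1_iff intro: input_reachable.from_input)
next
  case (from_state y x)
  obtain j b i a where yx: "y = (j, b)" "x = (i, a)"
    by (metis surj_pair)
  then have "(Inr b, a) \<in> system_bipartite_edges (A' \<or>\<^sub>m H) B'"
    using from_state.hyps by (auto simp: composed_dynamics_eq_1_iff matrix_or_eq_1_iff)
  then show ?case
    using from_state.IH yx by (auto intro: input_reachable.from_state)
qed

text \<open>
  No edge of the pattern enters a source subsystem from another one, so a path that ends there
  stays inside it and uses edges of the isolated component only.
\<close>

lemma source_reachable_imp_isolated_reachable:
  assumes "ia \<in> input_reachable (system_bipartite_edges (composed_dynamics A' H E) (composed_input B')) UNIV"
    and "is_source (condensed_graph E) (fst ia)"
  shows "snd ia \<in> input_reachable (system_bipartite_edges A' B') UNIV"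
  using assms
proof induction
  case (from_input u x)
  obtain j b i a where "u = (j, b)" "x = (i, a)"
    by (metis surj_pair)
  with from_input show ?case
    by (auto simp: composed_input_eq_1_iff intro: input_reachable.from_input)
next
  case (from_state y x)
  obtain j b i a where yx: "y = (j, b)" "x = (i, a)"
    by (metis surj_pair)
  then have "j = i" "A' $ a $ b = 1"
    using from_state.hyps from_state.prems
    by (auto simp: composed_dynamics_eq_1_iff is_source_def condensed_graph_def)
  then show ?case
    using from_state yx by (auto intro: input_reachable.from_state)
qed

text \<open>
  The claim is needed for all subsystems at once: an edge of \<open>H\<close> is lifted to one that comes from
  another subsystem, where the induction hypothesis is used.
\<close>

lemma component_reachable_imp_composed_reachable:
  assumes "a \<in> input_reachable (system_bipartite_edges (A' \<or>\<^sub>m H) B') UNIV"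
    and "\<nexists>v. is_source (condensed_graph E) v"
  shows "(i, a) \<in> input_reachable (system_bipartite_edges (composed_dynamics A' H E) (composed_input B')) UNIV"
  using assms(1)
proof (induction arbitrary: i)
  case (from_input u a)
  then have "(Inl (i, u), (i, a)) \<in> system_bipartite_edges (composed_dynamics A' H E) (composed_input B')"
    by (simp add: composed_input_eq_1_iff)
  then show ?case
    by (auto intro: input_reachable.from_input)
next
  case (from_state b a)
  obtain j where "E $ i $ j = 1"
    using assms(2) by (auto simp: is_source_def condensed_graph_def)
  then obtain k where "(Inr (k, b), (i, a)) \<in> system_bipartite_edges (composed_dynamics A' H E) (composed_input B')"
    using from_state.hyps by (auto simp: composed_dynamics_eq_1_iff matrix_or_eq_1_iff)
  then show ?case
    using from_state.IH[of k] by (blast intro: input_reachable.from_state)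
qed

lemma matches_matrix_or:
  assumes "matches (system_bipartite_edges A' B') UNIV UNIV f"
  shows "matches (system_bipartite_edges (A' \<or>\<^sub>m H) B') UNIV UNIV f"
proof -
  have "system_bipartite_edges A' B' \<subseteq> system_bipartite_edges (A' \<or>\<^sub>m H) B'"
    by (auto simp: system_bipartite_edges_def matrix_or_eq_1_iff)
  then show ?thesis
    using assms unfolding matches_def by blast
qed

lemma matches_composed:
  fixes A' H :: "bit ^ 'n ^ 'n" and B' :: "bit ^ 'p ^ 'n" and E :: "bit ^ 'r ^ 'r"
  assumes "matches (system_bipartite_edges A' B') UNIV UNIV f"
  shows "matches (system_bipartite_edges (composed_dynamics A' H E) (composed_input B')) UNIV UNIV
    (\<lambda>(i, a). map_sum (Pair i) (Pair i) (f a))"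
proof -
  have inj: "inj f" and edge: "\<And>a. (f a, a) \<in> system_bipartite_edges A' B'"
    using assms by (auto simp: matches_def)
  have "inj (\<lambda>(i :: 'r, a). map_sum (Pair i) (Pair i) (f a))"
  proof (rule injI, clarsimp)
    fix i i' :: 'r and a a'
    assume "map_sum (Pair i) (Pair i) (f a) = map_sum (Pair i') (Pair i') (f a')"
    then have "i = i' \<and> f a = f a'"
      by (cases "f a"; cases "f a'") auto
    then show "i = i' \<and> a = a'"
      using inj by (auto dest: injD)
  qed
  moreover have "(map_sum (Pair i) (Pair i) (f a), (i, a)) \<in>
      system_bipartite_edges (composed_dynamics A' H E) (composed_input B')" for i a
    using edge[of a] by (cases "f a") (auto simp: composed_dynamics_eq_1_iff composed_input_eq_1_iff)
  moreover have "l \<in> range Inl \<union> range Inr" for l :: "'x + 'y"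
    by (cases l) auto
  ultimately show ?thesis
    unfolding matches_def by (auto split: prod.splits)
qed

theorem theorem2:
  fixes A' H :: "bit ^ 'n ^ 'n" and B' :: "bit ^ 'p ^ 'n" and E :: "bit ^ 'r ^ 'r"
    and A :: "bit ^ ('r \<times> 'n) ^ ('r \<times> 'n)" and B :: "bit ^ ('r \<times> 'p) ^ ('r \<times> 'n)"
  assumes "\<And>i. E $ i $ i = 0"
    and "A = composed_dynamics A' H E"
    and "B = composed_input B'"
    and "\<not> structurally_controllable A' B'"
    and "\<exists>F. bipartite_matching (system_bipartite_edges A' B') F \<and> (\<nexists>v. right_unmatched F v)"
  shows "structurally_controllable A B \<longleftrightarrow>
    structurally_controllable (A' \<or>\<^sub>m H) B' \<and> (\<nexists>v. is_source (condensed_graph E) v)"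
proof -
  obtain f where f: "matches (system_bipartite_edges A' B') UNIV UNIV f"
    using assms(5) matching_imp_matches by blast
  have iff: "structurally_controllable S R \<longleftrightarrow> input_reachable (system_bipartite_edges S R) UNIV = UNIV"
    if "matches (system_bipartite_edges S R) UNIV UNIV g"
    for S :: "bit ^ 'm ^ 'm" and R :: "bit ^ 'q ^ 'm" and g
    using reachable_matched_imp_structurally_controllable[OF _ that]
      structurally_controllable_imp_input_reachable by blast
  show ?thesis
  proof
    assume "structurally_controllable A B"
    then have reach: "ia \<in> input_reachable (system_bipartite_edges (composed_dynamics A' H E) (composed_input B')) UNIV"
      for ia
      using structurally_controllable_imp_input_reachable assms(2,3) by blast
    have "a \<in> input_reachable (system_bipartite_edges (A' \<or>\<^sub>m H) B') UNIV" for a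
      using composed_reachable_imp_component_reachable[OF reach] by (metis snd_conv)
    then have "structurally_controllable (A' \<or>\<^sub>m H) B'"
      using reachable_matched_imp_structurally_controllable[OF _ matches_matrix_or[OF f]] by blast
    moreover have "\<not> is_source (condensed_graph E) v" for v
    proof
      assume "is_source (condensed_graph E) v"
      then have "a \<in> input_reachable (system_bipartite_edges A' B') UNIV" for a
        using source_reachable_imp_isolated_reachable[OF reach, of "(v, a)"] by simp
      then show False
        using reachable_matched_imp_structurally_controllable[OF _ f] assms(4) by blast
    qed
    ultimately show "structurally_controllable (A' \<or>\<^sub>m H) B' \<and> (\<nexists>v. is_source (condensed_graph E) v)"
      by blast
  next
    assume R: "structurally_controllable (A' \<or>\<^sub>m H) B' \<and> (\<nexists>v. is_source (condensed_graph E) v)"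
    then have "a \<in> input_reachable (system_bipartite_edges (A' \<or>\<^sub>m H) B') UNIV" for a
      using structurally_controllable_imp_input_reachable by blast
    then have "ia \<in> input_reachable (system_bipartite_edges A B) UNIV" for ia
      using component_reachable_imp_composed_reachable R unfolding assms(2,3) by (metis surj_pair)
    then show "structurally_controllable A B"
      using reachable_matched_imp_structurally_controllable[OF _ matches_composed[OF f]]
      unfolding assms(2,3) by blast
  qed
qed

end
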